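(* Let $f,g$ be closed, convex and proper functions, and let $(\bm{x}^\star,\bm{\lambda}^\star)$ be a primal-dual optimal solution pair for ADMM applied to minimizing $f(\bm{x})+g(\bm{x})$. For a step-size $\gamma>0$ the ADMM fixed point is $\sqrt{\gamma}\,\bm{x}^\star+\bm{\lambda}^\star/\sqrt{\gamma}$. Then $$\underset{\gamma>0}{\text{minimize}}\ \big\|\sqrt{\gamma}\,\bm{x}^\star+\bm{\lambda}^\star/\sqrt{\gamma}\big\|^2$$ is the same problem (up to an additive constant independent of $\gamma$) as $$\underset{\gamma>0}{\text{minimize}}\ \gamma\|\bm{x}^\star\|^2+\frac{1}{\gamma}\|\bm{\lambda}^\star\|^2,$$ and the minimum is obtained if and only if $\gamma\|\bm{x}^\star\|^2=\frac{1}{\gamma}\|\bm{\lambda}^\star\|^2$. This gives the optimal step-size $$\gamma^\star=\frac{\|\bm{\lambda}^\star\|}{\|\bm{x}^\star\|},$$ which meets the positivity requirement and is therefore a feasible solution.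
   Context: $\|\cdot\|$ is the Euclidean norm. The problem $\min_{\bm{x}} f(\bm{x})+g(\bm{x})$ is written as minimizing $f(\bm{x})+g(\bm{z})$ subject to $\bm{x}-\bm{z}=0$, and ADMM with step-size $\gamma>0$ uses the augmented Lagrangian $f(\bm{x})+g(\bm{z})+\langle\bm{\lambda},\bm{x}-\bm{z}\rangle+\frac{\gamma}{2}\|\bm{x}-\bm{z}\|^2$, minimizing in $\bm{x}$, then in $\bm{z}$, then updating $\bm{\lambda}^{k+1}=\bm{\lambda}^k+\gamma(\bm{x}^{k+1}-\bm{z}^{k+1})$. The pair $(\bm{x}^\star,\bm{\lambda}^\star)$ is kept fixed while $\gamma$ varies. The fixed point is the one associated with the sequence $\bm{\psi}^{k+1}=\sqrt{\gamma}\bm{x}^{k+1}+\bm{\lambda}^k/\sqrt{\gamma}$. With zero initialization $\bm{\psi}^0=0$, the squared norm $\|\bm{\psi}^\star\|^2$ of the fixed point is the constant in the worst-case convergence rate bound $\|\bm{\psi}^{k+1}-\bm{\psi}^k\|^2\le\frac{1}{k+1}\|\bm{\psi}^\star-\bm{\psi}^0\|^2$, and "optimal step-size" means the one minimizing this constant over $\gamma>0$.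
   Formalization: The final claim, that the step-size ‖λ*‖/‖x*‖ is positive and optimal, is stated for x* ≠ 0 and λ* ≠ 0: for x* = 0 the quotient is undefined, and for λ* = 0 it is 0, hence not positive. *)

theory Defs
  imports "HOL-Analysis.Analysis"
begin

text \<open>The library's \<open>epigraph\<close> is for real-valued functions only; here functions may take the
  values \<open>\<plusminus>\<infinity>\<close>, with the second coordinate of the epigraph still a real number.\<close>

definition ereal_epigraph :: "('a \<Rightarrow> ereal) \<Rightarrow> ('a \<times> real) set" where
  "ereal_epigraph f = {(x, r). f x \<le> ereal r}"

definition closed_fun :: "('a::euclidean_space \<Rightarrow> ereal) \<Rightarrow> bool" where
  "closed_fun f \<longleftrightarrow> closed (ereal_epigraph f)"

definition convex_fun :: "('a::euclidean_space \<Rightarrow> ereal) \<Rightarrow> bool" where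
  "convex_fun f \<longleftrightarrow> convex (ereal_epigraph f)"

definition proper_fun :: "('a::euclidean_space \<Rightarrow> ereal) \<Rightarrow> bool" where
  "proper_fun f \<longleftrightarrow> (\<exists>x. f x < \<infinity>) \<and> (\<forall>x. f x > -\<infinity>)"

definition lagrangian ::
  "('a::euclidean_space \<Rightarrow> ereal) \<Rightarrow> ('a \<Rightarrow> ereal) \<Rightarrow> 'a \<Rightarrow> 'a \<Rightarrow> 'a \<Rightarrow> ereal" where
  "lagrangian f g x z l = f x + g z + ereal (l \<bullet> (x - z))"

definition dual_fun ::
  "('a::euclidean_space \<Rightarrow> ereal) \<Rightarrow> ('a \<Rightarrow> ereal) \<Rightarrow> 'a \<Rightarrow> ereal" where
  "dual_fun f g l = (INF (x, z) \<in> UNIV. lagrangian f g x z l)"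

text \<open>\<open>xs\<close> solves the primal problem with a finite value, \<open>ls\<close> solves the dual problem, and there is
  no duality gap; this is the same as \<open>(xs, xs, ls)\<close> being a saddle point of the Lagrangian.\<close>

definition primal_dual_optimal ::
  "('a::euclidean_space \<Rightarrow> ereal) \<Rightarrow> ('a \<Rightarrow> ereal) \<Rightarrow> 'a \<Rightarrow> 'a \<Rightarrow> bool" where
  "primal_dual_optimal f g xs ls \<longleftrightarrow>
     f xs + g xs < \<infinity> \<and>
     (\<forall>x. f xs + g xs \<le> f x + g x) \<and>
     (\<forall>l. dual_fun f g l \<le> dual_fun f g ls) \<and>
     f xs + g xs = dual_fun f g ls"

definition aug_lagrangian ::
  "real \<Rightarrow> ('a::euclidean_space \<Rightarrow> ereal) \<Rightarrow> ('a \<Rightarrow> ereal) \<Rightarrow> 'a \<Rightarrow> 'a \<Rightarrow> 'a \<Rightarrow> ereal" where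
  "aug_lagrangian \<gamma> f g x z l = lagrangian f g x z l + ereal (\<gamma> / 2 * (norm (x - z))\<^sup>2)"

text \<open>One ADMM iteration from \<open>(z, l)\<close> to \<open>(x', z', l')\<close>. It is a relation, so that existence and
  uniqueness of the minimizers are not built in. The \<open>x\<close>-update is the intended one only when
  \<open>g z < \<infinity>\<close>, since otherwise its objective is identically \<open>\<infinity>\<close>; this is satisfied at a
  primal-dual optimal pair and after every iteration whose \<open>x'\<close> lies in the domain of \<open>f\<close>.\<close>

definition admm_step ::
  "real \<Rightarrow> ('a::euclidean_space \<Rightarrow> ereal) \<Rightarrow> ('a \<Rightarrow> ereal) \<Rightarrow> 'a \<Rightarrow> 'a \<Rightarrow> 'a \<Rightarrow> 'a \<Rightarrow> 'a \<Rightarrow> bool" where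
  "admm_step \<gamma> f g z l x' z' l' \<longleftrightarrow>
     is_arg_min (\<lambda>u. aug_lagrangian \<gamma> f g u z l) (\<lambda>_. True) x' \<and>
     is_arg_min (\<lambda>w. aug_lagrangian \<gamma> f g x' w l) (\<lambda>_. True) z' \<and>
     l' = l + \<gamma> *\<^sub>R (x' - z')"

definition admm_run ::
  "real \<Rightarrow> ('a::euclidean_space \<Rightarrow> ereal) \<Rightarrow> ('a \<Rightarrow> ereal) \<Rightarrow>
    (nat \<Rightarrow> 'a) \<Rightarrow> (nat \<Rightarrow> 'a) \<Rightarrow> (nat \<Rightarrow> 'a) \<Rightarrow> bool" where
  "admm_run \<gamma> f g x z l \<longleftrightarrow>
     (\<forall>k. admm_step \<gamma> f g (z k) (l k) (x (Suc k)) (z (Suc k)) (l (Suc k)))"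

text \<open>The sequence with entries \<open>sqrt \<gamma> x\<^sup>k\<^sup>+\<^sup>1 + \<lambda>\<^sup>k / sqrt \<gamma>\<close>: entry \<open>k\<close> here is
  \<open>\<psi>\<^sup>k\<^sup>+\<^sup>1\<close>, as \<open>\<psi>\<^sup>0\<close> is an initial value and not given by the formula.\<close>

definition admm_psi :: "real \<Rightarrow> (nat \<Rightarrow> 'a::euclidean_space) \<Rightarrow> (nat \<Rightarrow> 'a) \<Rightarrow> nat \<Rightarrow> 'a" where
  "admm_psi \<gamma> x l k = sqrt \<gamma> *\<^sub>R x (Suc k) + (1 / sqrt \<gamma>) *\<^sub>R l k"

text \<open>The pair \<open>(xs, ls)\<close>, with \<open>z = xs\<close>, is reproduced by an ADMM iteration, and every run started
  there has its \<open>\<psi>\<close>-sequence constantly equal to the given \<open>\<psi>\<close>.\<close>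

definition admm_fixed_point ::
  "real \<Rightarrow> ('a::euclidean_space \<Rightarrow> ereal) \<Rightarrow> ('a \<Rightarrow> ereal) \<Rightarrow> 'a \<Rightarrow> 'a \<Rightarrow> 'a \<Rightarrow> bool" where
  "admm_fixed_point \<gamma> f g xs ls \<psi> \<longleftrightarrow>
     admm_step \<gamma> f g xs ls xs xs ls \<and>
     (\<forall>x z l. admm_run \<gamma> f g x z l \<and> z 0 = xs \<and> l 0 = ls \<longrightarrow> (\<forall>k. admm_psi \<gamma> x l k = \<psi>))"

end

theory Submission
  imports Defs
begin

text \<open>Strong duality bounds the Lagrangian at \<open>ls\<close> from below by the optimal value, which it
  attains at \<open>(xs, xs)\<close>. Each ADMM subproblem at the optimal pair therefore minimizes a function
  with minimizer \<open>xs\<close> plus a quadratic penalty that vanishes only at \<open>xs\<close>, so \<open>xs\<close> is its only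
  solution. Expanding the square, the cross term \<open>2 (xs \<bullet> ls)\<close> does not depend on \<open>\<gamma>\<close>; what remains
  is \<open>\<gamma> a + b / \<gamma>\<close>, minimal exactly at its critical points.\<close>

lemma primal_dual_optimal_lagrangian_ge:
  assumes "primal_dual_optimal f g xs ls"
  shows "f xs + g xs \<le> lagrangian f g u w ls"
proof -
  have "dual_fun f g ls \<le> lagrangian f g u w ls"
    unfolding dual_fun_def by (rule INF_lower2[of "(u, w)"]) auto
  then show ?thesis
    using assms by (simp add: primal_dual_optimal_def)
qed

text \<open>Properness excludes the value -infinity and optimality excludes infinity. A real optimal
  value can be cancelled from inequalities between extended reals.\<close>

lemma primal_dual_optimal_finite:
  assumes "primal_dual_optimal f g xs ls" "proper_fun f" "proper_fun g"
  obtains p where "f xs + g xs = ereal p"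
proof -
  have "f xs + g xs < \<infinity>" "f xs > -\<infinity>" "g xs > -\<infinity>"
    using assms by (auto simp: primal_dual_optimal_def proper_fun_def)
  then show thesis
    using that by (cases "f xs"; cases "g xs") auto
qed

lemma is_arg_min_quadratic_penalty:
  fixes F :: "'a::real_normed_vector \<Rightarrow> ereal"
  assumes "\<gamma> > 0" and lower: "\<And>u. ereal p \<le> F u" and attained: "F a = ereal p"
  shows "is_arg_min (\<lambda>u. F u + ereal (\<gamma> / 2 * (norm (u - a))\<^sup>2)) (\<lambda>_. True) x \<longleftrightarrow> x = a"
proof
  assume "is_arg_min (\<lambda>u. F u + ereal (\<gamma> / 2 * (norm (u - a))\<^sup>2)) (\<lambda>_. True) x"
  then have "F x + ereal (\<gamma> / 2 * (norm (x - a))\<^sup>2) \<le> ereal p"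
    using attained by (auto simp: is_arg_min_linorder dest: spec[of _ a])
  \<comment> \<open>\<open>F x\<close> may be infinite and cannot be cancelled, so the real lower
    bound \<open>p\<close> replaces it. The penalty is then at most 0.\<close>
  moreover have "ereal p + ereal (\<gamma> / 2 * (norm (x - a))\<^sup>2)
      \<le> F x + ereal (\<gamma> / 2 * (norm (x - a))\<^sup>2)"
    using lower by (rule add_right_mono)
  ultimately have "ereal (p + \<gamma> / 2 * (norm (x - a))\<^sup>2) \<le> ereal p"
    by (metis order_trans plus_ereal.simps(1))
  then show "x = a"
    using \<open>\<gamma> > 0\<close> by (simp add: mult_le_0_iff)
next
  assume "x = a"
  moreover have "ereal p \<le> F u + ereal (\<gamma> / 2 * (norm (u - a))\<^sup>2)" for u
    using add_mono[OF lower[of u], of 0 "ereal (\<gamma> / 2 * (norm (u - a))\<^sup>2)"] \<open>\<gamma> > 0\<close>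
    by simp
  ultimately show "is_arg_min (\<lambda>u. F u + ereal (\<gamma> / 2 * (norm (u - a))\<^sup>2)) (\<lambda>_. True) x"
    using attained by (simp add: is_arg_min_linorder)
qed

text \<open>The \<open>x\<close>-update forces \<open>x' = xs\<close>, so the
  \<open>z\<close>-update is a penalized problem centred at \<open>xs\<close> as well, and the
  multiplier receives the increment 0. The equivalence supplies both the existence of a step and its
  uniqueness.\<close>

lemma admm_step_primal_dual_optimal_iff:
  assumes opt: "primal_dual_optimal f g xs ls" and "proper_fun f" "proper_fun g" and "\<gamma> > 0"
  shows "admm_step \<gamma> f g xs ls x' z' l' \<longleftrightarrow> x' = xs \<and> z' = xs \<and> l' = ls"
proof -
  obtain p where p: "f xs + g xs = ereal p"
    using primal_dual_optimal_finite assms by blast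
  have lower: "ereal p \<le> lagrangian f g u w ls" for u w
    using primal_dual_optimal_lagrangian_ge[OF opt] p by metis
  have attained: "lagrangian f g xs xs ls = ereal p"
    using p by (simp add: lagrangian_def)
  have "is_arg_min (\<lambda>u. aug_lagrangian \<gamma> f g u xs ls) (\<lambda>_. True) x' \<longleftrightarrow> x' = xs"
    unfolding aug_lagrangian_def
    using lower attained \<open>\<gamma> > 0\<close>
    by (intro is_arg_min_quadratic_penalty[where F = "\<lambda>u. lagrangian f g u xs ls"])
  moreover have "is_arg_min (\<lambda>w. aug_lagrangian \<gamma> f g xs w ls) (\<lambda>_. True) z' \<longleftrightarrow> z' = xs"
    unfolding aug_lagrangian_def
    \<comment> \<open>In the \<open>z\<close>-update the variable is the second argument of the
      difference; the penalty lemma expects it first.\<close>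
    unfolding norm_minus_commute[of xs]
    using lower attained \<open>\<gamma> > 0\<close>
    by (intro is_arg_min_quadratic_penalty[where F = "\<lambda>w. lagrangian f g xs w ls"])
  ultimately show ?thesis
    by (auto simp: admm_step_def)
qed

lemma admm_fixed_point_primal_dual_optimal:
  assumes "primal_dual_optimal f g xs ls" "proper_fun f" "proper_fun g" "\<gamma> > 0"
  shows "admm_fixed_point \<gamma> f g xs ls (sqrt \<gamma> *\<^sub>R xs + (1 / sqrt \<gamma>) *\<^sub>R ls)"
proof -
  note step_iff = admm_step_primal_dual_optimal_iff[OF assms]
  have "admm_psi \<gamma> x l k = sqrt \<gamma> *\<^sub>R xs + (1 / sqrt \<gamma>) *\<^sub>R ls"
    if run: "admm_run \<gamma> f g x z l" and "z 0 = xs" "l 0 = ls" for x z l k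
  proof -
    have step: "admm_step \<gamma> f g (z j) (l j) (x (Suc j)) (z (Suc j)) (l (Suc j))" for j
      using run by (simp add: admm_run_def)
    \<comment> \<open>The induction leaves out \<open>x\<close>: a run does not constrain
      \<open>x 0\<close>, and \<open>admm_psi\<close> only reads \<open>x (Suc k)\<close>.\<close>
    have stationary: "z j = xs \<and> l j = ls" for j
    proof (induction j)
      case 0
      then show ?case using that by simp
    next
      case (Suc j)
      then show ?case using step[of j] step_iff by simp
    qed
    then have "x (Suc k) = xs"
      using step[of k] step_iff by simp
    then show ?thesis
      using stationary by (simp add: admm_psi_def)
  qed
  then show ?thesis
    using step_iff by (auto simp: admm_fixed_point_def)
qed

text \<open>The weights \<open>sqrt t\<close> and \<open>1 / sqrt t\<close> have product 1, which
  removes \<open>t\<close> from the inner product.\<close>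

lemma power2_norm_scaleR_sqrt_add:
  fixes x y :: "'a::real_inner"
  assumes "t > 0"
  shows "(norm (sqrt t *\<^sub>R x + (1 / sqrt t) *\<^sub>R y))\<^sup>2
    = t * (norm x)\<^sup>2 + 1 / t * (norm y)\<^sup>2 + 2 * (x \<bullet> y)"
proof -
  have "(norm (u + v))\<^sup>2 = (norm u)\<^sup>2 + (norm v)\<^sup>2 + 2 * (u \<bullet> v)" for u v :: 'a
    by (simp add: dot_norm field_simps)
  from this[of "sqrt t *\<^sub>R x" "(1 / sqrt t) *\<^sub>R y"] show ?thesis
    using assms by (simp add: power_mult_distrib power_divide)
qed

lemma is_arg_min_add_const_cong:
  fixes F G :: "'a \<Rightarrow> real"
  assumes "\<And>t. P t \<Longrightarrow> F t = G t + c"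
  shows "is_arg_min F P x \<longleftrightarrow> is_arg_min G P x"
  using assms by (auto simp: is_arg_min_def)

lemma is_arg_min_linear_plus_inverse_iff:
  fixes a b \<gamma> :: real
  assumes "a \<ge> 0" "\<gamma> > 0"
  shows "is_arg_min (\<lambda>t. t * a + 1 / t * b) (\<lambda>t. t > 0) \<gamma> \<longleftrightarrow> \<gamma> * a = 1 / \<gamma> * b"
proof
  assume min: "is_arg_min (\<lambda>t. t * a + 1 / t * b) (\<lambda>t. t > 0) \<gamma>"
  have "((\<lambda>t. t * a + 1 / t * b) has_real_derivative a - b / \<gamma>\<^sup>2) (at \<gamma>)"
    using \<open>\<gamma> > 0\<close> by (auto intro!: derivative_eq_intros simp: power2_eq_square)
  \<comment> \<open>The radius \<gamma> keeps every such \<open>t\<close> positive, so minimality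
    over the half-line gives a local minimum, as Fermat's rule requires.\<close>
  moreover have "\<forall>t. \<bar>\<gamma> - t\<bar> < \<gamma> \<longrightarrow> \<gamma> * a + 1 / \<gamma> * b \<le> t * a + 1 / t * b"
    using min by (auto simp: is_arg_min_linorder)
  ultimately have "a - b / \<gamma>\<^sup>2 = 0"
    using \<open>\<gamma> > 0\<close> DERIV_local_min by blast
  then show "\<gamma> * a = 1 / \<gamma> * b"
    using \<open>\<gamma> > 0\<close> by (simp add: field_simps power2_eq_square)
next
  assume "\<gamma> * a = 1 / \<gamma> * b"
  then have b: "b = \<gamma>\<^sup>2 * a"
    using \<open>\<gamma> > 0\<close> by (simp add: field_simps power2_eq_square)
  have "\<gamma> * a + 1 / \<gamma> * b \<le> t * a + 1 / t * b" if "t > 0" for t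
  proof -
    \<comment> \<open>Substituting \<open>b\<close> completes the square, so a critical point is a
      global minimizer.\<close>
    have "t * a + 1 / t * b - (\<gamma> * a + 1 / \<gamma> * b) = a * (t - \<gamma>)\<^sup>2 / t"
      using that \<open>\<gamma> > 0\<close> by (simp add: b field_simps power2_eq_square)
    also have "\<dots> \<ge> 0"
      using that \<open>a \<ge> 0\<close> by simp
    finally show ?thesis by simp
  qed
  then show "is_arg_min (\<lambda>t. t * a + 1 / t * b) (\<lambda>t. t > 0) \<gamma>"
    using \<open>\<gamma> > 0\<close> by (simp add: is_arg_min_linorder)
qed

theorem mainTheorem1:
  fixes f g :: "'a::euclidean_space \<Rightarrow> ereal" and xs ls :: 'a
  assumes "closed_fun f" "convex_fun f" "proper_fun f"
    and "closed_fun g" "convex_fun g" "proper_fun g"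
    and "primal_dual_optimal f g xs ls"
  shows "(\<forall>\<gamma>>0. admm_fixed_point \<gamma> f g xs ls (sqrt \<gamma> *\<^sub>R xs + (1 / sqrt \<gamma>) *\<^sub>R ls)) \<and>
    (\<exists>c. \<forall>\<gamma>>0. (norm (sqrt \<gamma> *\<^sub>R xs + (1 / sqrt \<gamma>) *\<^sub>R ls))\<^sup>2
                 = \<gamma> * (norm xs)\<^sup>2 + 1 / \<gamma> * (norm ls)\<^sup>2 + c) \<and>
    (\<forall>\<gamma>. is_arg_min (\<lambda>t. (norm (sqrt t *\<^sub>R xs + (1 / sqrt t) *\<^sub>R ls))\<^sup>2) (\<lambda>t. t > 0) \<gamma>
           \<longleftrightarrow> is_arg_min (\<lambda>t. t * (norm xs)\<^sup>2 + 1 / t * (norm ls)\<^sup>2) (\<lambda>t. t > 0) \<gamma>) \<and>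
    (\<forall>\<gamma>>0. is_arg_min (\<lambda>t. t * (norm xs)\<^sup>2 + 1 / t * (norm ls)\<^sup>2) (\<lambda>t. t > 0) \<gamma>
           \<longleftrightarrow> \<gamma> * (norm xs)\<^sup>2 = 1 / \<gamma> * (norm ls)\<^sup>2) \<and>
    (xs \<noteq> 0 \<and> ls \<noteq> 0 \<longrightarrow>
       norm ls / norm xs > 0 \<and>
       (\<forall>\<gamma>. is_arg_min (\<lambda>t. (norm (sqrt t *\<^sub>R xs + (1 / sqrt t) *\<^sub>R ls))\<^sup>2) (\<lambda>t. t > 0) \<gamma>
              \<longleftrightarrow> \<gamma> = norm ls / norm xs))"
proof -
  let ?\<psi> = "\<lambda>t. (norm (sqrt t *\<^sub>R xs + (1 / sqrt t) *\<^sub>R ls))\<^sup>2"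
  let ?h = "\<lambda>t. t * (norm xs)\<^sup>2 + 1 / t * (norm ls)\<^sup>2"
  have fixed: "\<forall>\<gamma>>0. admm_fixed_point \<gamma> f g xs ls (sqrt \<gamma> *\<^sub>R xs + (1 / sqrt \<gamma>) *\<^sub>R ls)"
    using assms admm_fixed_point_primal_dual_optimal by blast
  have expand: "?\<psi> t = ?h t + 2 * (xs \<bullet> ls)" if "t > 0" for t
    using that by (rule power2_norm_scaleR_sqrt_add)
  have same: "is_arg_min ?\<psi> (\<lambda>t. t > 0) \<gamma> \<longleftrightarrow> is_arg_min ?h (\<lambda>t. t > 0) \<gamma>" for \<gamma>
    by (rule is_arg_min_add_const_cong) (rule expand)
  have crit: "is_arg_min ?h (\<lambda>t. t > 0) \<gamma> \<longleftrightarrow> \<gamma> * (norm xs)\<^sup>2 = 1 / \<gamma> * (norm ls)\<^sup>2"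
    if "\<gamma> > 0" for \<gamma>
    using that by (intro is_arg_min_linear_plus_inverse_iff) auto
  \<comment> \<open>If exactly one of \<open>xs\<close> and \<open>ls\<close> is 0, the critical
    equation has no positive solution; if both are 0, every positive \<gamma> solves it. A unique
    optimal step-size thus needs both to be nonzero.\<close>
  have opt: "is_arg_min ?\<psi> (\<lambda>t. t > 0) \<gamma> \<longleftrightarrow> \<gamma> = norm ls / norm xs"
    if "xs \<noteq> 0" "ls \<noteq> 0" for \<gamma>
  proof (cases "\<gamma> > 0")
    case True
    then have "\<gamma> * (norm xs)\<^sup>2 = 1 / \<gamma> * (norm ls)\<^sup>2 \<longleftrightarrow> (\<gamma> * norm xs)\<^sup>2 = (norm ls)\<^sup>2"
      by (simp add: field_simps power2_eq_square)
    also have "\<dots> \<longleftrightarrow> \<gamma> * norm xs = norm ls"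
      using True by (simp add: power2_eq_iff_nonneg)
    also have "\<dots> \<longleftrightarrow> \<gamma> = norm ls / norm xs"
      using that by (simp add: field_simps)
    finally show ?thesis
      using same crit[OF True] by simp
  next
    \<comment> \<open>Both sides fail: such a \<gamma> is infeasible, and the quotient of the norms
      is positive.\<close>
    case False
    moreover have "norm ls / norm xs > 0"
      using that by simp
    ultimately show ?thesis
      by (auto simp: is_arg_min_def)
  qed
  have "\<exists>c. \<forall>\<gamma>>0. ?\<psi> \<gamma> = ?h \<gamma> + c"
    using expand by blast
  moreover have "xs \<noteq> 0 \<and> ls \<noteq> 0 \<longrightarrow> norm ls / norm xs > 0 \<and>
      (\<forall>\<gamma>. is_arg_min ?\<psi> (\<lambda>t. t > 0) \<gamma> \<longleftrightarrow> \<gamma> = norm ls / norm xs)"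
    using opt by simp
  ultimately show ?thesis
    using fixed same crit by blast
qed

end
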